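(* Let $D$ be a weakly locally finite division ring with center $F$. Then $\operatorname{GKdim}_F D$ is either a non-negative integer or $\infty$.
   Context: A division ring $D$ is weakly locally finite if for every finite subset $S\subseteq D$, the division subring of $D$ generated by $S$ is finite dimensional over its own center. For an algebra $A$ over a field $k$, the Gelfand–Kirillov dimension is $\operatorname{GKdim}_k(A)=\sup_V \limsup_{r\to\infty}\log_r \dim_k V^r$, where $V$ ranges over finite dimensional subspaces of $A$ containing $1$ with $\sum_{r\ge1}V^r=A$ (subframes), and $V^r$ is the span of all products of $r$ elements of $V$. The GK dimension of a division ring is that of the division ring as an algebra over its center.
   Formalization: GKdim is the supremum over all finite dimensional subspaces V containing 1; the condition that the powers V^r sum to A is dropped, since no such V exists when D is not finitely generated over F; both definitions agree when D is finitely generated. *)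

theory Defs
  imports "HOL-Analysis.Analysis" "HOL-Library.Liminf_Limsup"
begin

definition center :: "'a::division_ring set" where
  "center = {z. \<forall>x. z * x = x * z}"

definition division_subring :: "'a::division_ring set \<Rightarrow> bool" where
  "division_subring K \<longleftrightarrow> 0 \<in> K \<and> 1 \<in> K \<and>
     (\<forall>x\<in>K. \<forall>y\<in>K. x + y \<in> K \<and> x * y \<in> K) \<and>
     (\<forall>x\<in>K. - x \<in> K) \<and> (\<forall>x\<in>K. x \<noteq> 0 \<longrightarrow> inverse x \<in> K)"

definition gen_division_subring :: "'a::division_ring set \<Rightarrow> 'a set" where
  "gen_division_subring S = \<Inter> {K. division_subring K \<and> S \<subseteq> K}"

definition center_of :: "'a::division_ring set \<Rightarrow> 'a set" where
  "center_of K = {z \<in> K. \<forall>x\<in>K. z * x = x * z}"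

definition fspan :: "'a::division_ring set \<Rightarrow> 'a set \<Rightarrow> 'a set" where
  "fspan F S = {x. \<exists>T c. finite T \<and> T \<subseteq> S \<and> (\<forall>t\<in>T. c t \<in> F) \<and> x = (\<Sum>t\<in>T. c t * t)}"

definition fin_dim :: "'a::division_ring set \<Rightarrow> 'a set \<Rightarrow> bool" where
  "fin_dim F V \<longleftrightarrow> (\<exists>T. finite T \<and> fspan F T = V)"

text \<open>Dimension (for finite dimensional V): least size of a finite spanning set.\<close>
definition fdim :: "'a::division_ring set \<Rightarrow> 'a set \<Rightarrow> nat" where
  "fdim F V = (LEAST n. \<exists>T. finite T \<and> card T = n \<and> fspan F T = V)"

definition weakly_locally_finite :: "'a::division_ring itself \<Rightarrow> bool" where
  "weakly_locally_finite _ \<longleftrightarrow>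
     (\<forall>S :: 'a set. finite S \<longrightarrow>
        (let K = gen_division_subring S in fin_dim (center_of K) K))"

definition spow :: "'a::division_ring set \<Rightarrow> 'a set \<Rightarrow> nat \<Rightarrow> 'a set" where
  "spow F V r = fspan F {prod_list xs | xs. length xs = r \<and> set xs \<subseteq> V}"

text \<open>Gelfand-Kirillov dimension of the algebra (type 'a) over the central subfield F:
  supremum over finite dimensional subspaces V containing 1 (i.e. subframes of the
  finitely generated subalgebras) of limsup log_r dim V^r.\<close>
definition GKdim :: "'a::division_ring set \<Rightarrow> ereal" where
  "GKdim F = Sup {limsup (\<lambda>r::nat. ereal (log (real r) (real (fdim F (spow F V r))))) | V.
                    fspan F V = V \<and> fin_dim F V \<and> (1::'a) \<in> V}"

end

theory Submission
  imports Defs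
begin

text \<open>
  Let \<open>X\<close> be a finite set of commuting elements. Adjoining its elements one at a time, an element
  algebraic over the previous ones changes the growth of the generated algebra only by constant
  factors, whereas a transcendental one raises the degree of growth by exactly one. So the growth
  of a finitely generated commutative subalgebra is polynomial of an integral degree.

  An arbitrary finite set \<open>T\<close> generates a division ring \<open>K\<close> spanned over its center by a finite set
  \<open>E\<close>. If \<open>W\<close> consists of the coordinates with respect to \<open>E\<close> of \<open>1\<close> and of the products \<open>t * e\<close>,
  then the powers of \<open>T\<close> lie in the module spanned by \<open>E\<close> over the powers of \<open>W \<union> {1}\<close>, hence \<open>T\<close>
  grows no faster than the commuting set \<open>W \<union> {1}\<close>. The GK dimension is therefore a supremum of
  natural numbers.
\<close>

subsection \<open>Linear algebra over the center\<close>

text \<open>The center is made into a type of class \<^class>\<open>field\<close>, so that the linear algebra of the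
  locale \<^locale>\<open>vector_space\<close> applies to subspaces over it.\<close>

typedef (overloaded) 'a ctr = "center :: 'a::division_ring set"
  by (auto simp: center_def intro: exI[of _ 0])

setup_lifting type_definition_ctr

lemma centerI: "(\<And>x. z * x = x * z) \<Longrightarrow> z \<in> center"
  by (simp add: center_def)

lemma centerD: "z \<in> center \<Longrightarrow> z * x = x * z"
  by (simp add: center_def)

lemma inverse_commute:
  fixes z x :: "'a::division_ring"
  assumes "z * x = x * z"
  shows "inverse z * x = x * inverse z"
proof (cases "z = 0")
  case False
  have "inverse z * x = inverse z * (x * z) * inverse z"
    using False by (simp add: mult.assoc)
  also have "\<dots> = x * inverse z"
    using False by (simp flip: assms mult.assoc)
  finally show ?thesis .
qed simp

instantiation ctr :: (division_ring) field
begin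

lift_definition zero_ctr :: "'a ctr" is 0
  by (simp add: center_def)

lift_definition one_ctr :: "'a ctr" is 1
  by (simp add: center_def)

lift_definition plus_ctr :: "'a ctr \<Rightarrow> 'a ctr \<Rightarrow> 'a ctr" is "(+)"
  by (simp add: center_def distrib_left distrib_right)

lift_definition minus_ctr :: "'a ctr \<Rightarrow> 'a ctr \<Rightarrow> 'a ctr" is "(-)"
  by (simp add: center_def left_diff_distrib right_diff_distrib)

lift_definition uminus_ctr :: "'a ctr \<Rightarrow> 'a ctr" is uminus
  by (simp add: center_def)

lift_definition times_ctr :: "'a ctr \<Rightarrow> 'a ctr \<Rightarrow> 'a ctr" is "(*)"
  by (metis centerD centerI mult.assoc)

lift_definition inverse_ctr :: "'a ctr \<Rightarrow> 'a ctr" is inverse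
  by (simp add: center_def inverse_commute)

definition divide_ctr :: "'a ctr \<Rightarrow> 'a ctr \<Rightarrow> 'a ctr" where
  "divide_ctr x y = x * inverse y"

instance
proof
  fix a b c :: "'a ctr"
  show "a * b * c = a * (b * c)" by transfer (simp add: mult.assoc)
  show "a * b = b * a" by transfer (simp add: centerD)
  show "1 * a = a" by transfer simp
  show "a + b + c = a + (b + c)" by transfer (simp add: add.assoc)
  show "a + b = b + a" by transfer (simp add: add.commute)
  show "0 + a = a" by transfer simp
  show "- a + a = 0" by transfer simp
  show "a - b = a + - b" by transfer simp
  show "(a + b) * c = a * c + b * c" by transfer (simp add: distrib_right)
  show "(0::'a ctr) \<noteq> 1" by transfer simp
  show "a \<noteq> 0 \<Longrightarrow> inverse a * a = 1" by transfer simp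
  show "a div b = a * inverse b" by (simp add: divide_ctr_def)
  show "inverse (0::'a ctr) = 0" by transfer simp
qed

end

definition cscale :: "'a::division_ring ctr \<Rightarrow> 'a \<Rightarrow> 'a" where
  "cscale c x = Rep_ctr c * x"

global_interpretation cv: vector_space "cscale :: 'a::division_ring ctr \<Rightarrow> 'a \<Rightarrow> 'a"
  by unfold_locales
    (simp_all add: cscale_def distrib_left distrib_right plus_ctr.rep_eq times_ctr.rep_eq
      one_ctr.rep_eq mult.assoc)

lemma cscale_mult_left: "cscale c x * y = cscale c (x * y)"
  by (simp add: cscale_def mult.assoc)

lemma cscale_mult_right: "x * cscale c y = cscale c (x * y)"
  by (metis Rep_ctr centerD cscale_def mult.assoc)

text \<open>This bridge makes bases and exchange from \<open>vector_space\<close> available for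
  \<open>fdim center\<close>.\<close>

lemma fspan_center: "fspan center S = cv.span S"
proof (intro set_eqI iffI)
  fix x assume "x \<in> fspan center S"
  then obtain T c where *: "finite T" "T \<subseteq> S" "\<And>t. t \<in> T \<Longrightarrow> c t \<in> center"
    "x = (\<Sum>t\<in>T. c t * t)"
    unfolding fspan_def by auto
  have "x = (\<Sum>t\<in>T. cscale (Abs_ctr (c t)) t)"
    using * by (simp add: cscale_def Abs_ctr_inverse)
  then show "x \<in> cv.span S"
    using *(1,2) unfolding cv.span_explicit
    by (intro CollectI exI[of _ T] exI[of _ "\<lambda>t. Abs_ctr (c t)"]) simp
next
  fix x assume "x \<in> cv.span S"
  then obtain T c where *: "finite T" "T \<subseteq> S" "x = (\<Sum>t\<in>T. cscale (c t) t)"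
    unfolding cv.span_explicit by blast
  then show "x \<in> fspan center S"
    unfolding fspan_def cscale_def
    by (auto intro!: exI[of _ T] exI[of _ "\<lambda>t. Rep_ctr (c t)"] simp: Rep_ctr)
qed

text \<open>\<open>fdim\<close> counts sets spanning exactly \<open>V\<close>, whereas
  \<open>T\<close> may span a larger space. A maximal independent subset of \<open>V\<close> does
  span \<open>V\<close>, and by exchange it is no larger than \<open>T\<close>.\<close>

lemma fdim_center_le:
  assumes "finite T" "cv.subspace V" "V \<subseteq> cv.span T"
  shows "fdim center V \<le> card T"
proof -
  obtain B where B: "B \<subseteq> V" "cv.independent B" "V \<subseteq> cv.span B"
    using cv.maximal_independent_subset by blast
  then have "finite B \<and> card B \<le> card T"
    using assms by (intro cv.independent_span_bound) auto
  moreover have "cv.span B = V"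
    using B assms(2) by (simp add: cv.span_subspace)
  ultimately have "fdim center V \<le> card B"
    unfolding fdim_def fspan_center by (intro Least_le) blast
  then show ?thesis
    using \<open>finite B \<and> card B \<le> card T\<close> by simp
qed

lemma fdim_center_witness:
  assumes "fin_dim center V"
  obtains T where "finite T" "card T = fdim center V" "cv.span T = V"
proof -
  from assms have "\<exists>n T. finite T \<and> card T = n \<and> fspan center T = V"
    by (auto simp: fin_dim_def)
  then have "\<exists>T. finite T \<and> card T = fdim center V \<and> fspan center T = V"
    unfolding fdim_def by (rule LeastI_ex)
  then show thesis
    using that by (auto simp: fspan_center)
qed

text \<open>Finite dimensionality ensures that the least size in \<open>fdim\<close> is attained by
  a spanning set; exchange then bounds every independent set by it.\<close>

lemma card_le_fdim_center:
  assumes "fin_dim center V" "B \<subseteq> V" "cv.independent B"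
  shows "card B \<le> fdim center V"
proof -
  obtain T where "finite T" "card T = fdim center V" "cv.span T = V"
    using assms(1) by (rule fdim_center_witness)
  then show ?thesis
    using cv.independent_span_bound[OF _ assms(3), of T] assms(2) by simp
qed

lemma fdim_center_basis:
  assumes "fin_dim center V"
  obtains B where "finite B" "cv.independent B" "card B = fdim center V" "cv.span B = V"
proof -
  obtain T where T: "finite T" "card T = fdim center V" "cv.span T = V"
    using assms by (rule fdim_center_witness)
  obtain B where B: "B \<subseteq> V" "cv.independent B" "V \<subseteq> cv.span B"
    using cv.maximal_independent_subset by blast
  have sub: "cv.subspace V" using T(3) cv.subspace_span by blast
  have fin: "finite B"
    using cv.independent_span_bound[OF T(1) B(2)] B(1) T(3) by blast
  have "card B = fdim center V"
    using card_le_fdim_center[OF assms B(1,2)] fdim_center_le[OF fin sub B(3)] by simp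
  moreover have "cv.span B = V"
    using B sub by (simp add: cv.span_subspace)
  ultimately show thesis using that fin B by blast
qed

lemma fdim_center_mono:
  assumes "fin_dim center V" "fin_dim center W" "V \<subseteq> W"
  shows "fdim center V \<le> fdim center W"
proof -
  obtain B where B: "cv.independent B" "card B = fdim center V" "cv.span B = V"
    using assms(1) by (rule fdim_center_basis)
  then have "B \<subseteq> W" using cv.span_superset[of B] assms(3) by simp
  then show ?thesis
    using card_le_fdim_center[OF assms(2) _ B(1)] B(2) by simp
qed

text \<open>Central scalars move past \<open>a\<close>, so left multiplication by \<open>a\<close>
  is linear over the center and only generators have to be checked.\<close>

lemma span_mult_left_closed:
  assumes "x \<in> cv.span A" "cv.subspace V" "\<And>x. x \<in> A \<Longrightarrow> a * x \<in> V"
  shows "a * x \<in> V"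
  using assms(1)
proof (induction rule: cv.span_induct_alt)
  case base
  then show ?case using assms(2) by (simp add: cv.subspace_0)
next
  case (step c x y)
  then show ?case
    using assms by (simp add: distrib_left cscale_mult_right cv.subspace_add cv.subspace_scale)
qed

lemma span_mult_right_closed:
  assumes "x \<in> cv.span A" "cv.subspace V" "\<And>x. x \<in> A \<Longrightarrow> x * a \<in> V"
  shows "x * a \<in> V"
  using assms(1)
proof (induction rule: cv.span_induct_alt)
  case base
  then show ?case using assms(2) by (simp add: cv.subspace_0)
next
  case (step c x y)
  then show ?case
    using assms by (simp add: distrib_right cscale_mult_left cv.subspace_add cv.subspace_scale)
qed

lemma span_commute:
  assumes "x \<in> cv.span A" "\<And>x. x \<in> A \<Longrightarrow> x * a = a * x"
  shows "x * a = a * x"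
  using assms(1)
proof (induction rule: cv.span_induct_alt)
  case (step c x y)
  then show ?case
    using assms(2) by (simp add: distrib_right distrib_left cscale_mult_left cscale_mult_right)
qed simp

subsection \<open>Powers of a set\<close>

lemma subspace_spow: "cv.subspace (spow center U r)"
  by (simp add: spow_def fspan_center)

lemma fin_dim_center_span: "finite T \<Longrightarrow> fin_dim center (cv.span T)"
  unfolding fin_dim_def fspan_center by blast

lemma prod_list_in_spow: "set xs \<subseteq> U \<Longrightarrow> prod_list xs \<in> spow center U (length xs)"
  unfolding spow_def fspan_center by (blast intro: cv.span_base)

lemma fin_dim_spow:
  assumes "finite U"
  shows "fin_dim center (spow center U r)"
proof -
  have "{prod_list xs |xs. length xs = r \<and> set xs \<subseteq> U} = prod_list ` {xs. set xs \<subseteq> U \<and> length xs = r}"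
    by auto
  then show ?thesis
    using assms by (simp add: spow_def fspan_center fin_dim_center_span finite_lists_length_eq)
qed

lemma spow_mono_base: "U \<subseteq> U' \<Longrightarrow> spow center U r \<subseteq> spow center U' r"
  unfolding spow_def fspan_center by (rule cv.span_mono) blast

lemma spow_least:
  assumes "cv.subspace V" "\<And>xs. length xs = r \<Longrightarrow> set xs \<subseteq> U \<Longrightarrow> prod_list xs \<in> V"
  shows "spow center U r \<subseteq> V"
  unfolding spow_def fspan_center using assms by (intro cv.span_minimal) auto

lemma spow_mono_exponent:
  assumes "1 \<in> U" "r \<le> s"
  shows "spow center U r \<subseteq> spow center U s"
proof (rule spow_least[OF subspace_spow])
  fix xs assume "length xs = r" "set xs \<subseteq> U"
  \<comment> \<open>Short words are padded with the letter 1.\<close>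
  then show "prod_list xs \<in> spow center U s"
    using assms prod_list_in_spow[of "xs @ replicate (s - r) 1" U]
    by (simp add: set_replicate_conv_if)
qed

lemma spow_mult:
  assumes "x \<in> spow center U r" "y \<in> spow center U s"
  shows "x * y \<in> spow center U (r + s)"
proof -
  \<comment> \<open>Bilinearity is used one side at a time: first the left factor is a single word,
    then it varies over the span of words.\<close>
  have 1: "prod_list xs * y \<in> spow center U (length xs + s)" if "set xs \<subseteq> U" for xs
    using assms(2) unfolding spow_def[of _ _ s] fspan_center
  proof (rule span_mult_left_closed[OF _ subspace_spow])
    fix z assume "z \<in> {prod_list ys |ys. length ys = s \<and> set ys \<subseteq> U}"
    then show "prod_list xs * z \<in> spow center U (length xs + s)"
      using that prod_list_in_spow[of "xs @ _" U] by auto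
  qed
  show ?thesis
    using assms(1) unfolding spow_def[of _ _ r] fspan_center
    by (rule span_mult_right_closed[OF _ subspace_spow]) (auto intro: 1)
qed

lemma in_spow_1: "x \<in> U \<Longrightarrow> x \<in> spow center U 1"
  using prod_list_in_spow[of "[x]" U] by simp

lemma one_in_spow: "1 \<in> U \<Longrightarrow> 1 \<in> spow center U r"
  using prod_list_in_spow[of "replicate r 1" U] by (simp add: set_replicate_conv_if)

lemma power_in_spow: "x \<in> U \<Longrightarrow> x ^ r \<in> spow center U r"
  using prod_list_in_spow[of "replicate r x" U] by (simp add: set_replicate_conv_if)

text \<open>The GK dimension is defined by subspaces, the growth estimates concern finite sets.
  Nothing is lost in between, because a product of \<open>r\<close> linear combinations expands into
  words of length \<open>r\<close>.\<close>

lemma spow_span: "spow center (cv.span U) r = spow center U r"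
proof (rule antisym)
  have "prod_list xs \<in> spow center U (length xs)" if "set xs \<subseteq> cv.span U" for xs
    using that
  proof (induction xs)
    case Nil
    then show ?case using prod_list_in_spow[of "[]" U] by simp
  next
    case (Cons x xs)
    have "U \<subseteq> spow center U 1" using in_spow_1 by blast
    then have "cv.span U \<subseteq> spow center U 1"
      using subspace_spow by (rule cv.span_minimal)
    then have "x \<in> spow center U 1"
      using Cons.prems by auto
    moreover have "prod_list xs \<in> spow center U (length xs)"
      using Cons by simp
    ultimately show ?case using spow_mult[of x U 1] by simp
  qed
  then show "spow center (cv.span U) r \<subseteq> spow center U r"
    by (intro spow_least[OF subspace_spow]) blast
qed (simp add: spow_mono_base cv.span_superset)

lemma spow_commute:
  assumes "x \<in> spow center U r" "\<And>u. u \<in> U \<Longrightarrow> u * a = a * u"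
  shows "x * a = a * x"
proof -
  have "prod_list xs * a = a * prod_list xs" if "set xs \<subseteq> U" for xs
    using that by (induction xs) (auto simp: mult.assoc assms(2), simp flip: mult.assoc add: assms(2))
  then show ?thesis
    using assms(1) span_commute unfolding spow_def fspan_center by blast
qed

subsection \<open>Finite extensions\<close>

text \<open>This is the left module generated by \<open>E\<close> over the algebra generated by
  \<open>U\<close>, filtered by the degree \<open>k\<close> of the coefficients.\<close>

definition spow_ext :: "'a::division_ring set \<Rightarrow> 'a set \<Rightarrow> nat \<Rightarrow> 'a set" where
  "spow_ext U E k = cv.span ((\<lambda>(p, e). p * e) ` (spow center U k \<times> E))"

lemma subspace_spow_ext: "cv.subspace (spow_ext U E k)"
  by (simp add: spow_ext_def)

lemma spow_extI: "p \<in> spow center U k \<Longrightarrow> e \<in> E \<Longrightarrow> p * e \<in> spow_ext U E k"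
  unfolding spow_ext_def by (rule cv.span_base) auto

lemma spow_ext_mult_left:
  assumes "p \<in> spow center U k" "q \<in> spow_ext U E l"
  shows "p * q \<in> spow_ext U E (k + l)"
  using assms(2) unfolding spow_ext_def[of _ _ l]
proof (rule span_mult_left_closed[OF _ subspace_spow_ext])
  fix x assume "x \<in> (\<lambda>(p, e). p * e) ` (spow center U l \<times> E)"
  then obtain p' e where "p' \<in> spow center U l" "e \<in> E" "x = p' * e" by auto
  then show "p * x \<in> spow_ext U E (k + l)"
    using spow_extI[OF spow_mult[OF assms(1)]] by (simp flip: mult.assoc)
qed

lemma spow_ext_mono:
  assumes "1 \<in> U" "k \<le> l"
  shows "spow_ext U E k \<subseteq> spow_ext U E l"
  unfolding spow_ext_def using spow_mono_exponent[OF assms] by (intro cv.span_mono image_mono Sigma_mono) auto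

lemma spow_ext_subset_span:
  assumes "cv.span B = spow center U k"
  shows "spow_ext U E k \<subseteq> cv.span ((\<lambda>(b, e). b * e) ` (B \<times> E))"
  unfolding spow_ext_def
proof (rule cv.span_minimal[OF _ cv.subspace_span], rule subsetI)
  fix x assume "x \<in> (\<lambda>(p, e). p * e) ` (spow center U k \<times> E)"
  then obtain p e where x: "p \<in> cv.span B" "e \<in> E" "x = p * e"
    using assms by auto
  show "x \<in> cv.span ((\<lambda>(b, e). b * e) ` (B \<times> E))"
    unfolding x(3) using x(1) cv.subspace_span
  proof (rule span_mult_right_closed)
    fix b assume "b \<in> B"
    then have "(b, e) \<in> B \<times> E" using x(2) by simp
    then show "b * e \<in> cv.span ((\<lambda>(b, e). b * e) ` (B \<times> E))"
      by (intro cv.span_base image_eqI[of _ _ "(b, e)"]) simp_all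
  qed
qed

text \<open>Products of a basis of the coefficient space with \<open>E\<close> span the module. Left
  multiplication by \<open>inverse a\<close> is linear over the center and carries them to a set
  whose span contains \<open>V\<close>.\<close>

lemma fdim_center_le_spow_ext:
  assumes "finite U" "finite E" "cv.subspace V" "a \<noteq> 0"
    and "\<And>x. x \<in> V \<Longrightarrow> a * x \<in> spow_ext U E k"
  shows "fdim center V \<le> card E * fdim center (spow center U k)"
proof -
  obtain B where B: "finite B" "card B = fdim center (spow center U k)" "cv.span B = spow center U k"
    using fin_dim_spow[OF assms(1)] by (rule fdim_center_witness)
  let ?G = "(\<lambda>(b, e). b * e) ` (B \<times> E)"
  have "V \<subseteq> cv.span ((*) (inverse a) ` ?G)"
  proof
    fix x assume "x \<in> V"
    then have "a * x \<in> cv.span ?G"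
      using assms(5) spow_ext_subset_span[OF B(3)] by blast
    then have "inverse a * (a * x) \<in> cv.span ((*) (inverse a) ` ?G)"
      using cv.subspace_span by (rule span_mult_left_closed) (intro cv.span_base imageI)
    then show "x \<in> cv.span ((*) (inverse a) ` ?G)"
      using \<open>a \<noteq> 0\<close> by (simp flip: mult.assoc)
  qed
  then have "fdim center V \<le> card ((*) (inverse a) ` ?G)"
    by (intro fdim_center_le finite_imageI finite_cartesian_product B(1) assms(2,3))
  also have "\<dots> \<le> card (B \<times> E)"
    using B(1) assms(2) by (meson card_image_le finite_SigmaI finite_imageI le_trans)
  finally show ?thesis
    by (simp add: card_cartesian_product B(2) mult.commute)
qed

text \<open>Multiplication by the powers of the common denominator \<open>c\<close> moves the powers of \<open>U'\<close> into
  the finitely generated module spanned by \<open>E\<close>; being injective, it preserves dimensions.\<close>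

lemma fdim_spow_le_finite_extension:
  assumes "finite U" "finite E" "c \<noteq> 0"
    and c_U': "\<And>u. u \<in> U' \<Longrightarrow> c * u = u * c"
    and c_U: "\<And>x. x \<in> U \<Longrightarrow> x * c = c * x"
    and U_U': "\<And>x u. x \<in> U \<Longrightarrow> u \<in> U' \<Longrightarrow> x * u = u * x"
    and closed: "\<And>u e. u \<in> U' \<Longrightarrow> e \<in> E \<Longrightarrow> c * u * e \<in> spow_ext U E s"
    and one: "1 \<in> spow_ext U E s"
  shows "fdim center (spow center U' r) \<le> card E * fdim center (spow center U (s + s * r))"
proof (rule fdim_center_le_spow_ext[OF assms(1,2) subspace_spow])
  show "c ^ r \<noteq> 0" using \<open>c \<noteq> 0\<close> by simp
next
  \<comment> \<open>The coefficients in \<open>U\<close> commute with \<open>c\<close> and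
    \<open>u\<close>, so \<open>c * u\<close> passes them and acts on a generator in
    \<open>E\<close>, at the cost of degree \<open>s\<close>.\<close>
  have step: "c * u * q \<in> spow_ext U E (k + s)" if "u \<in> U'" "q \<in> spow_ext U E k" for u q k
    using that(2) unfolding spow_ext_def[of _ _ k]
  proof (rule span_mult_left_closed[OF _ subspace_spow_ext])
    fix x assume "x \<in> (\<lambda>(p, e). p * e) ` (spow center U k \<times> E)"
    then obtain p e where p: "p \<in> spow center U k" "e \<in> E" "x = p * e" by auto
    have "p * (c * u) = c * u * p"
      by (rule spow_commute[OF p(1)]) (metis c_U U_U' that(1) mult.assoc)
    then have "c * u * x = p * (c * u * e)"
      using p(3) by (metis mult.assoc)
    then show "c * u * x \<in> spow_ext U E (k + s)"
      using spow_ext_mult_left[OF p(1) closed[OF that(1) p(2)]] by simp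
  qed
  \<comment> \<open>The first \<open>s\<close> is the degree in which 1 lies in the module; each
    letter then uses up one factor \<open>c\<close> and adds another \<open>s\<close>.\<close>
  have "c ^ length xs * prod_list xs \<in> spow_ext U E (s + s * length xs)" if "set xs \<subseteq> U'" for xs
    using that
  proof (induction xs)
    case Nil
    then show ?case using one by simp
  next
    case (Cons u xs)
    have "c ^ length xs * u = u * c ^ length xs"
      using c_U' Cons.prems by (simp add: power_commuting_commutes)
    then have "c ^ length (u # xs) * prod_list (u # xs) = c * u * (c ^ length xs * prod_list xs)"
      by (simp add: mult.assoc) (metis mult.assoc)
    moreover have "c * u * (c ^ length xs * prod_list xs) \<in> spow_ext U E (s + s * length xs + s)"
      using Cons by (intro step) auto
    moreover have "s + s * length xs + s = s + s * length (u # xs)"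
      by simp
    ultimately show ?case by metis
  qed
  then show "c ^ r * x \<in> spow_ext U E (s + s * r)" if "x \<in> spow center U' r" for x
    using that unfolding spow_def[of _ _ r] fspan_center
    by (elim span_mult_left_closed[OF _ subspace_spow_ext]) auto
qed

subsection \<open>Growth of commuting sets\<close>

text \<open>Independence of the image set does not exclude repetitions, so counting also needs
  injectivity: a repetition would be a relation with coefficients 1 and -1.\<close>

lemma independent_family:
  assumes "finite I"
    and indep: "\<And>f i. (\<Sum>i\<in>I. cscale (f i) (g i)) = 0 \<Longrightarrow> i \<in> I \<Longrightarrow> f i = 0"
  shows "inj_on g I" "cv.independent (g ` I)"
proof -
  show inj: "inj_on g I"
  proof (rule inj_onI, rule ccontr)
    fix i j assume ij: "i \<in> I" "j \<in> I" "g i = g j" "i \<noteq> j"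
    let ?f = "\<lambda>k. (if k = i then 1 else 0) - (if k = j then 1 else 0)"
    have "(\<Sum>k\<in>I. cscale (?f k) (g k)) =
        (\<Sum>k\<in>I. if k = i then g k else 0) - (\<Sum>k\<in>I. if k = j then g k else 0)"
      unfolding sum_subtractf[symmetric]
      by (intro sum.cong) (auto simp: cv.scale_left_diff_distrib)
    also have "\<dots> = 0"
      using ij assms(1) by simp
    finally show False
      using indep[of ?f i] ij by simp
  qed
  show "cv.independent (g ` I)"
  proof (rule cv.independent_if_scalars_zero)
    fix f x assume *: "(\<Sum>x\<in>g ` I. cscale (f x) x) = 0" "x \<in> g ` I"
    then have "(\<Sum>i\<in>I. cscale (f (g i)) (g i)) = 0"
      by (simp add: sum.reindex[OF inj])
    then show "f x = 0"
      using indep[of "\<lambda>i. f (g i)"] *(2) by blast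
  qed (use assms(1) in simp)
qed

text \<open>For commuting \<open>U \<union> {y}\<close> this says that \<open>y\<close> is algebraic over the field of fractions of the
  algebra generated by \<open>U\<close>: denominators are cleared, and the coefficients lie in one common power.\<close>

definition algebraic_over :: "'a::division_ring set \<Rightarrow> 'a \<Rightarrow> bool" where
  "algebraic_over U y \<longleftrightarrow> (\<exists>a k N. (\<forall>i\<le>N. a i \<in> spow center U k) \<and>
     (\<Sum>i\<le>N. a i * y ^ i) = 0 \<and> a N \<noteq> 0)"

text \<open>Cutting a nontrivial relation off at its last nonzero coefficient makes the leading
  coefficient nonzero.\<close>

lemma algebraic_over_if_relation:
  fixes N :: nat
  assumes "\<And>i. i \<le> N \<Longrightarrow> a i \<in> spow center U k" "(\<Sum>i\<le>N. a i * y ^ i) = 0"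
    and "j \<le> N" "a j \<noteq> 0"
  shows "algebraic_over U y"
proof -
  define M where "M = (GREATEST i. i \<le> N \<and> a i \<noteq> 0)"
  have M: "M \<le> N" "a M \<noteq> 0"
    using GreatestI_nat[of "\<lambda>i. i \<le> N \<and> a i \<noteq> 0" j N] assms(3,4) unfolding M_def by auto
  have gt: "a i = 0" if "M < i" "i \<le> N" for i
  proof (rule ccontr)
    assume "a i \<noteq> 0"
    then have "i \<le> M"
      unfolding M_def using \<open>i \<le> N\<close> by (intro Greatest_le_nat[where b = N]) auto
    then show False using \<open>M < i\<close> by simp
  qed
  have "(\<Sum>i\<le>M. a i * y ^ i) = (\<Sum>i\<le>N. a i * y ^ i)"
    using M(1) gt by (intro sum.mono_neutral_left) auto
  then have "(\<forall>i\<le>M. a i \<in> spow center U k) \<and> (\<Sum>i\<le>M. a i * y ^ i) = 0 \<and> a M \<noteq> 0"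
    using M assms(1,2) by simp
  then show ?thesis
    unfolding algebraic_over_def by blast
qed

text \<open>For a basis \<open>B\<close> of the \<open>r\<close>-th power of \<open>U\<close>, the
  products \<open>b * y ^ i\<close> with \<open>i\<close> at most \<open>r\<close> are independent.
  Both factors have degree at most \<open>r\<close>, whence the exponent
  \<open>2 * r\<close>.\<close>

lemma fdim_spow_insert_ge:
  assumes "finite U" "1 \<in> U" "\<not> algebraic_over U y"
  shows "(r + 1) * fdim center (spow center U r) \<le> fdim center (spow center (insert y U) (2 * r))"
proof -
  obtain B where B: "finite B" "cv.independent B" "card B = fdim center (spow center U r)"
    "cv.span B = spow center U r"
    using fin_dim_spow[OF assms(1)] by (rule fdim_center_basis)
  let ?g = "\<lambda>(b, i). b * y ^ i" and ?I = "B \<times> {..r}"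
  have zero: "f i = 0" if f: "(\<Sum>i\<in>?I. cscale (f i) (?g i)) = 0" and i: "i \<in> ?I" for f i
  proof -
    obtain b j where bj: "i = (b, j)" "b \<in> B" "j \<le> r" using i by auto
    \<comment> \<open>Grouping the relation by powers of \<open>y\<close> gives a polynomial
      relation for \<open>y\<close>. Each \<open>a j\<close> vanishes since \<open>y\<close> is not
      algebraic, and then each coefficient vanishes by independence of \<open>B\<close>.\<close>
    define a where "a j = (\<Sum>b\<in>B. cscale (f (b, j)) b)" for j
    have a: "a j \<in> spow center U r" for j
      unfolding a_def B(4)[symmetric] by (intro cv.span_sum cv.span_scale cv.span_base)
    have "(\<Sum>j\<le>r. a j * y ^ j) = (\<Sum>j\<le>r. \<Sum>b\<in>B. cscale (f (b, j)) (b * y ^ j))"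
      by (simp add: a_def sum_distrib_right cscale_mult_left)
    also have "\<dots> = (\<Sum>b\<in>B. \<Sum>j\<le>r. cscale (f (b, j)) (b * y ^ j))"
      by (rule sum.swap)
    also have "\<dots> = 0"
      using f by (simp add: sum.cartesian_product case_prod_unfold)
    finally have "a j = 0"
      using algebraic_over_if_relation[of r a U r y j] a bj(3) assms(3) by blast
    then show "f i = 0"
      using cv.independentD[OF B(2,1) subset_refl, of "\<lambda>b. f (b, j)" b] bj by (simp add: a_def)
  qed
  have fin: "finite ?I" using B(1) by simp
  note indep = independent_family[of ?I ?g, OF fin]
  have inj: "inj_on ?g ?I" by (rule indep(1)) (rule zero)
  have ind: "cv.independent (?g ` ?I)" by (rule indep(2)) (rule zero)
  have "?g ` ?I \<subseteq> spow center (insert y U) (2 * r)"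
  proof clarsimp
    fix b i assume "b \<in> B" "i \<le> r"
    have "b \<in> spow center (insert y U) r"
      using \<open>b \<in> B\<close> B(4) cv.span_base spow_mono_base[of U "insert y U"] by blast
    moreover have "y ^ i \<in> spow center (insert y U) r"
      using power_in_spow[of y "insert y U" i] spow_mono_exponent[of "insert y U" i r] \<open>1 \<in> U\<close> \<open>i \<le> r\<close>
      by blast
    ultimately show "b * y ^ i \<in> spow center (insert y U) (2 * r)"
      using spow_mult by (metis mult_2)
  qed
  then have "card (?g ` ?I) \<le> fdim center (spow center (insert y U) (2 * r))"
    using assms(1) ind by (intro card_le_fdim_center fin_dim_spow) auto
  then show ?thesis
    by (simp add: card_image[OF inj] card_cartesian_product B(3)
        mult.commute)
qed

text \<open>Commutation lets every word of length \<open>r\<close> collect its letters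
  \<open>y\<close> on the right, which leaves \<open>r + 1\<close> possible exponents.\<close>

lemma fdim_spow_insert_le:
  assumes "finite U" "1 \<in> U" "\<And>u. u \<in> U \<Longrightarrow> y * u = u * y"
  shows "fdim center (spow center (insert y U) r) \<le> (r + 1) * fdim center (spow center U r)"
proof -
  have *: "\<exists>i p. i \<le> length xs \<and> p \<in> spow center U (length xs) \<and> prod_list xs = p * y ^ i"
    if "set xs \<subseteq> insert y U" for xs
    using that
  proof (induction xs)
    case Nil
    show ?case using one_in_spow[OF \<open>1 \<in> U\<close>, of 0] by auto
  next
    case (Cons x xs)
    then obtain i p where p: "i \<le> length xs" "p \<in> spow center U (length xs)" "prod_list xs = p * y ^ i"
      by auto
    show ?case
    proof (cases "x \<in> U")
      case True
      then have "x * p \<in> spow center U (length (x # xs))"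
        using spow_mult[OF in_spow_1 p(2)] by simp
      then show ?thesis
        using p(1,3) by (metis le_SucI length_Cons mult.assoc prod_list.Cons)
    next
      case False
      then have "x = y" using Cons.prems by simp
      moreover have "p * y = y * p"
        by (rule spow_commute[OF p(2)]) (simp add: assms(3))
      ultimately have "prod_list (x # xs) = p * y ^ Suc i"
        using p(3) by (simp flip: mult.assoc)
      moreover have "p \<in> spow center U (length (x # xs))"
        using p(2) spow_mono_exponent[OF \<open>1 \<in> U\<close>, of "length xs" "length (x # xs)"] by auto
      moreover have "Suc i \<le> length (x # xs)" using p(1) by simp
      ultimately show ?thesis by blast
    qed
  qed
  let ?E = "(\<lambda>i. y ^ i) ` {..r}"
  have "spow center (insert y U) r \<subseteq> spow_ext U ?E r"
  proof (rule spow_least[OF subspace_spow_ext])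
    fix xs assume "length xs = r" "set xs \<subseteq> insert y U"
    then show "prod_list xs \<in> spow_ext U ?E r"
      using *[of xs] spow_extI[of _ U r _ ?E] by auto
  qed
  then have "fdim center (spow center (insert y U) r) \<le> card ?E * fdim center (spow center U r)"
    using assms(1) by (intro fdim_center_le_spow_ext[where a = 1] subspace_spow) auto
  also have "\<dots> \<le> (r + 1) * fdim center (spow center U r)"
    using card_image_le[of "{..r}" "\<lambda>i. y ^ i"] by (intro mult_right_mono) auto
  finally show ?thesis .
qed

text \<open>The leading coefficient \<open>a N\<close> serves as common denominator: it turns
  \<open>y ^ N\<close> into a combination of lower powers, so the powers below \<open>N\<close>
  generate a module stable under multiplication by \<open>a N * u\<close>.\<close>

lemma fdim_spow_insert_algebraic:
  assumes "finite U" "1 \<in> U" "algebraic_over U y"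
    and comm: "\<And>u v. u \<in> insert y U \<Longrightarrow> v \<in> insert y U \<Longrightarrow> u * v = v * u"
  obtains N s where "\<And>r. fdim center (spow center (insert y U) r) \<le>
      N * fdim center (spow center U (s + s * r))"
proof -
  obtain a k N where a: "\<And>i. i \<le> N \<Longrightarrow> a i \<in> spow center U k"
    and rel: "(\<Sum>i\<le>N. a i * y ^ i) = 0" and "a N \<noteq> 0"
    using assms(3) unfolding algebraic_over_def by blast
  \<comment> \<open>This puts \<open>1 = y ^ 0\<close> among the generators
    \<open>?E\<close>.\<close>
  have "N > 0"
  proof (rule Nat.gr0I)
    assume "N = 0"
    then show False using rel \<open>a N \<noteq> 0\<close> by simp
  qed
  let ?E = "(\<lambda>i. y ^ i) ` {..<N}" and ?c = "a N"
  have lead: "?c * y ^ N \<in> spow_ext U ?E k"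
  proof -
    have "(\<Sum>i<N. a i * y ^ i) + ?c * y ^ N = 0"
      using rel by (simp add: lessThan_Suc_atMost[symmetric])
    then have "?c * y ^ N = - (\<Sum>i<N. a i * y ^ i)"
      by (simp add: add_eq_0_iff)
    then show ?thesis
      by (auto intro!: cv.subspace_neg cv.subspace_sum subspace_spow_ext spow_extI a)
  qed
  have c_comm: "?c * u = u * ?c" if "u \<in> insert y U" for u
    using spow_commute[OF a[OF order_refl], of u] comm that by blast
  \<comment> \<open>The degree \<open>k\<close> comes from the coefficients of the relation; the
    extra 1 accounts for a letter \<open>u\<close> from \<open>U\<close>.\<close>
  have closed: "?c * u * e \<in> spow_ext U ?E (k + 1)" if u: "u \<in> insert y U" and e: "e \<in> ?E" for u e
  proof -
    obtain i where i: "i < N" "e = y ^ i" using e by blast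
    show ?thesis
    proof (cases "u \<in> U")
      case True
      then have "?c * u \<in> spow center U (k + 1)"
        using spow_mult[OF a[OF order_refl] in_spow_1] by simp
      then show ?thesis using e by (rule spow_extI)
    next
      case False
      then have eq: "?c * u * e = ?c * y ^ Suc i"
        using u i by (simp add: mult.assoc)
      have "?c * y ^ Suc i \<in> spow_ext U ?E k"
      proof (cases "Suc i = N")
        case True
        then show ?thesis using lead by simp
      next
        case False
        then have "y ^ Suc i \<in> ?E" using i(1) by (intro imageI) simp
        then show ?thesis by (intro spow_extI a) simp
      qed
      then show ?thesis
        unfolding eq using spow_ext_mono[OF \<open>1 \<in> U\<close>, of k "k + 1" ?E] by auto
    qed
  qed
  have one: "1 \<in> spow_ext U ?E (k + 1)"
  proof -
    have "1 \<in> ?E" using \<open>N > 0\<close> by (intro image_eqI[of _ _ 0]) auto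
    then show ?thesis
      using spow_extI[OF one_in_spow[OF \<open>1 \<in> U\<close>], of 1 ?E] by simp
  qed
  have "fdim center (spow center (insert y U) r) \<le>
      card ?E * fdim center (spow center U ((k + 1) + (k + 1) * r))" for r
    using \<open>a N \<noteq> 0\<close> assms(1) comm c_comm closed one
    by (intro fdim_spow_le_finite_extension[where c = ?c]) auto
  then show thesis by (rule that)
qed

text \<open>The lower bound rescales the argument instead of dividing by \<open>C\<close>. This
  stays within natural numbers and absorbs the doubling of exponents caused by a transcendental
  element.\<close>

definition growth_degree :: "'a::division_ring set \<Rightarrow> nat \<Rightarrow> bool" where
  "growth_degree U d \<longleftrightarrow> (\<exists>C\<ge>1. \<forall>r\<ge>1. fdim center (spow center U r) \<le> C * r ^ d \<and>
     r ^ d \<le> fdim center (spow center U (C * r)))"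

lemma fdim_spow_mono_exponent:
  assumes "finite U" "1 \<in> U" "r \<le> s"
  shows "fdim center (spow center U r) \<le> fdim center (spow center U s)"
  using assms by (intro fdim_center_mono fin_dim_spow spow_mono_exponent)

text \<open>For positive \<open>r\<close>, \<open>s + s * r\<close> is at most
  \<open>2 * (s + 1) * r\<close>, and a linear change of argument affects a polynomial bound only by
  a constant factor.\<close>

lemma growth_degree_upper_extension:
  assumes "growth_degree U d" 
    and le: "\<And>r. fdim center (spow center U' r) \<le> N * fdim center (spow center U (s + s * r))"
    and "finite U" "1 \<in> U"
  obtains C where "C \<ge> 1" "\<And>r. r \<ge> 1 \<Longrightarrow> fdim center (spow center U' r) \<le> C * r ^ d"
proof -
  obtain C where C: "C \<ge> 1" "\<And>r. r \<ge> 1 \<Longrightarrow> fdim center (spow center U r) \<le> C * r ^ d"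
    using assms(1) unfolding growth_degree_def by blast
  \<comment> \<open>The summand 1 keeps the constant positive even if \<open>N\<close> is 0.\<close>
  have bound: "fdim center (spow center U' r) \<le> (1 + N * C * (2 * (s + 1)) ^ d) * r ^ d"
    if "r \<ge> 1" for r
  proof -
    have "s + s * r \<le> 2 * (s + 1) * r"
      using mult_le_mono2[OF that, of s] by (simp only: algebra_simps)
    then have "fdim center (spow center U (s + s * r)) \<le> fdim center (spow center U (2 * (s + 1) * r))"
      using assms by (intro fdim_spow_mono_exponent)
    also have "\<dots> \<le> C * (2 * (s + 1) * r) ^ d"
      using that by (intro C(2)) simp
    finally have "fdim center (spow center U' r) \<le> N * (C * (2 * (s + 1) * r) ^ d)"
      using le[of r] mult_le_mono2 le_trans by blast
    also have "\<dots> = N * C * (2 * (s + 1)) ^ d * r ^ d"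
      by (simp only: power_mult_distrib mult.assoc)
    also have "\<dots> \<le> (1 + N * C * (2 * (s + 1)) ^ d) * r ^ d"
      by (intro mult_right_mono) auto
    finally show ?thesis .
  qed
  show thesis
    by (rule that[OF _ bound]) auto
qed

lemma fdim_spow_one: "fdim center (spow center {1::'a::division_ring} r) = 1"
proof (rule antisym)
  have "prod_list xs = 1" if "set xs \<subseteq> {1::'a}" for xs
    using that by (induction xs) auto
  then have "spow center {1::'a} r \<subseteq> cv.span {1}"
    by (intro spow_least cv.subspace_span) (auto intro: cv.span_base)
  then show "fdim center (spow center {1::'a} r) \<le> 1"
    using fdim_center_le[of "{1::'a}", OF _ subspace_spow] by simp
  have "card {1::'a} \<le> fdim center (spow center {1::'a} r)"
    by (intro card_le_fdim_center fin_dim_spow) (auto simp: one_in_spow)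
  then show "1 \<le> fdim center (spow center {1::'a} r)" by simp
qed

lemma growth_degree_exists:
  fixes X :: "'a::division_ring set"
  assumes "finite X" "\<And>x y. x \<in> X \<Longrightarrow> y \<in> X \<Longrightarrow> x * y = y * x"
  shows "\<exists>d. growth_degree (insert 1 X) d"
  using assms
proof (induction X)
  case empty
  then show ?case
    by (intro exI[of _ 0]) (auto simp: growth_degree_def fdim_spow_one)
next
  case (insert y X)
  then obtain d where d: "growth_degree (insert 1 X) d" by auto
  define U where "U = insert 1 X"
  have U: "finite U" "1 \<in> U" "insert 1 (insert y X) = insert y U"
    using insert.hyps by (auto simp: U_def)
  have comm: "\<And>u v. u \<in> insert y U \<Longrightarrow> v \<in> insert y U \<Longrightarrow> u * v = v * u"
    using insert.prems by (auto simp: U_def)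
  obtain C where C: "C \<ge> 1" "\<And>r. r \<ge> 1 \<Longrightarrow> fdim center (spow center U r) \<le> C * r ^ d"
    "\<And>r. r \<ge> 1 \<Longrightarrow> r ^ d \<le> fdim center (spow center U (C * r))"
    using d unfolding growth_degree_def U_def by blast
  have base: "fdim center (spow center U r) \<le> fdim center (spow center (insert y U) r)" for r
    using U(1) by (intro fdim_center_mono fin_dim_spow spow_mono_base) auto
  have monoU: "fdim center (spow center (insert y U) r) \<le> fdim center (spow center (insert y U) s)"
    if "r \<le> s" for r s
    using U that by (intro fdim_spow_mono_exponent) auto
  show ?case
  proof (cases "algebraic_over U y")
    case True
    obtain N s where "\<And>r. fdim center (spow center (insert y U) r) \<le>
        N * fdim center (spow center U (s + s * r))"
      using fdim_spow_insert_algebraic[OF U(1,2) True comm] by blast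
    then obtain C' where C': "C' \<ge> 1"
      "\<And>r. r \<ge> 1 \<Longrightarrow> fdim center (spow center (insert y U) r) \<le> C' * r ^ d"
      using growth_degree_upper_extension[OF d[folded U_def] _ U(1,2)] by blast
    \<comment> \<open>One constant must serve both bounds: \<open>C'\<close> gives the upper one,
      \<open>C\<close> the lower one inherited from \<open>U\<close>, and both survive enlarging the
      constant.\<close>
    have "fdim center (spow center (insert y U) r) \<le> (C + C') * r ^ d \<and>
        r ^ d \<le> fdim center (spow center (insert y U) ((C + C') * r))" if "r \<ge> 1" for r
    proof
      show "fdim center (spow center (insert y U) r) \<le> (C + C') * r ^ d"
        using C'(2)[OF that] by (simp add: algebra_simps)
      have "r ^ d \<le> fdim center (spow center (insert y U) (C * r))"
        using C(3)[OF that] base le_trans by blast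
      also have "\<dots> \<le> fdim center (spow center (insert y U) ((C + C') * r))"
        by (rule monoU) simp
      finally show "r ^ d \<le> fdim center (spow center (insert y U) ((C + C') * r))" .
    qed
    then have "growth_degree (insert y U) d"
      unfolding growth_degree_def using C(1) by (intro exI[of _ "C + C'"]) auto
    then show ?thesis unfolding U(3) by blast
  next
    case False
    \<comment> \<open>Above, \<open>r + 1\<close> is at most \<open>2 * r\<close>. Below, the
      doubled exponent turns \<open>C * r\<close> into \<open>2 * C * r\<close>, and the factor
      \<open>C * r + 1\<close> supplies the additional power of \<open>r\<close>.\<close>
    have "fdim center (spow center (insert y U) r) \<le> (2 * C) * r ^ (d + 1) \<and>
        r ^ (d + 1) \<le> fdim center (spow center (insert y U) (2 * C * r))" if "r \<ge> 1" for r
    proof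
      have "fdim center (spow center (insert y U) r) \<le> (r + 1) * fdim center (spow center U r)"
        using U comm by (intro fdim_spow_insert_le) auto
      also have "\<dots> \<le> (2 * r) * (C * r ^ d)"
        using that C(2)[OF that] by (intro mult_mono) auto
      finally show "fdim center (spow center (insert y U) r) \<le> (2 * C) * r ^ (d + 1)"
        by (simp add: mult.assoc mult.left_commute)
      have "r ^ (d + 1) \<le> (C * r + 1) * fdim center (spow center U (C * r))"
        using C(3)[OF that] C(1) by (simp add: mult_mono trans_le_add2)
      also have "\<dots> \<le> fdim center (spow center (insert y U) (2 * C * r))"
        using fdim_spow_insert_ge[OF U(1,2) False, of "C * r"] by (simp add: mult.assoc)
      finally show "r ^ (d + 1) \<le> fdim center (spow center (insert y U) (2 * C * r))" .
    qed
    then have "growth_degree (insert y U) (d + 1)"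
      unfolding growth_degree_def using C(1) by (intro exI[of _ "2 * C"]) auto
    then show ?thesis unfolding U(3) by blast
  qed
qed

subsection \<open>Gelfand-Kirillov dimension\<close>

lemma const_over_ln_tendsto_0: "(\<lambda>n::nat. K / ln (real n)) \<longlonglongrightarrow> 0"
  by (rule real_tendsto_divide_at_top[OF tendsto_const])
    (rule filterlim_compose[OF ln_at_top filterlim_real_sequentially])

text \<open>The constant \<open>C\<close> contributes only \<open>ln C / ln r\<close> to the
  logarithm to base \<open>r\<close>, which tends to 0.\<close>

lemma limsup_log_le:
  fixes f :: "nat \<Rightarrow> nat"
  assumes "C \<ge> 1" "\<And>r. r \<ge> 1 \<Longrightarrow> f r \<le> C * r ^ d"
  shows "limsup (\<lambda>r. ereal (log (real r) (real (f r)))) \<le> ereal (real d)"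
proof -
  have "(\<lambda>r::nat. real d + ln (real C) / ln (real r)) \<longlonglongrightarrow> real d + 0"
    by (intro tendsto_intros const_over_ln_tendsto_0)
  then have lim: "(\<lambda>r::nat. ereal (real d + ln (real C) / ln (real r))) \<longlonglongrightarrow> ereal (real d)"
    by simp
  have "log (real r) (real (f r)) \<le> real d + ln (real C) / ln (real r)" if "r \<ge> 2" for r
  proof (cases "f r = 0")
    \<comment> \<open>The logarithm of 0 has the default value 0, and the right side is nonnegative
      because \<open>C\<close> is at least 1.\<close>
    case True
    then show ?thesis using that assms(1) by (simp add: log_def)
  next
    case False
    have "real (f r) \<le> real (C * r ^ d)"
      using assms(2)[of r] that by (simp only: of_nat_le_iff)
    then have "ln (real (f r)) \<le> ln (real C * real r ^ d)"
      using False that assms(1) by (subst ln_le_cancel_iff) auto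
    also have "\<dots> = ln (real C) + real d * ln (real r)"
      using that assms(1) by (simp add: ln_mult ln_realpow)
    finally show ?thesis
      using that by (simp add: log_def field_simps)
  qed
  then have "limsup (\<lambda>r. ereal (log (real r) (real (f r))))
      \<le> limsup (\<lambda>r::nat. ereal (real d + ln (real C) / ln (real r)))"
    by (intro Limsup_mono eventually_sequentiallyI[of 2]) simp
  also have "\<dots> = ereal (real d)"
    using lim by (intro lim_imp_Limsup) simp_all
  finally show ?thesis .
qed

text \<open>The bound is given only at multiples of \<open>C\<close>. Monotonicity extends it to all
  large \<open>n\<close> by rounding down to such a multiple, which costs a constant factor.\<close>

lemma limsup_log_ge:
  fixes f :: "nat \<Rightarrow> nat"
  assumes "C \<ge> 1" "\<And>r. r \<ge> 1 \<Longrightarrow> r ^ d \<le> f (C * r)" "mono f"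
  shows "ereal (real d) \<le> limsup (\<lambda>r. ereal (log (real r) (real (f r))))"
proof -
  \<comment> \<open>With \<open>q = n div C\<close>, \<open>n\<close> is at most
    \<open>2 * C * q\<close>; hence \<open>d * ln q\<close> falls short of \<open>d * ln n\<close>
    by at most \<open>K\<close>.\<close>
  define K where "K = real d * ln (2 * real C)"
  have "(\<lambda>r::nat. real d - K / ln (real r)) \<longlonglongrightarrow> real d - 0"
    by (intro tendsto_intros const_over_ln_tendsto_0)
  then have lim: "(\<lambda>r::nat. ereal (real d - K / ln (real r))) \<longlonglongrightarrow> ereal (real d)"
    by simp
  \<comment> \<open>From \<open>C + 1\<close> on, \<open>q\<close> is at least 1 and
    \<open>ln n\<close> is positive.\<close>
  have "real d - K / ln (real n) \<le> log (real n) (real (f n))" if "n \<ge> C + 1" for n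
  proof -
    define q where "q = n div C"
    have q: "q \<ge> 1" using that assms(1) by (simp add: q_def Suc_le_eq div_greater_zero_iff)
    have "n \<le> C * q + C"
      using assms(1) unfolding q_def
      by (metis add_left_mono mod_less_divisor less_imp_le mult_div_mod_eq less_le_trans zero_less_one)
    also have "\<dots> \<le> 2 * C * q" using q by (cases q) auto
    finally have nq: "real n \<le> 2 * real C * real q"
      by (metis of_nat_le_iff of_nat_mult of_nat_numeral)
    have "q ^ d \<le> f n"
      using assms(2)[OF q] monoD[OF assms(3), of "C * q" n] by (simp add: q_def)
    moreover have "q ^ d > 0" using q by simp
    ultimately have "ln (real (q ^ d)) \<le> ln (real (f n))"
      by (subst ln_le_cancel_iff) linarith+
    then have 1: "real d * ln (real q) \<le> ln (real (f n))"
      using q by (simp add: ln_realpow)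
    have "ln (real n) \<le> ln (2 * real C * real q)"
      using nq that q assms(1) by (subst ln_le_cancel_iff) auto
    also have "\<dots> = ln (2 * real C) + ln (real q)"
      using q assms(1) by (simp add: ln_mult)
    finally have "real d * ln (real n) \<le> real d * (ln (2 * real C) + ln (real q))"
      by (intro mult_left_mono) auto
    then have "real d * ln (real n) - K \<le> ln (real (f n))"
      using 1 by (simp add: K_def algebra_simps)
    moreover have pos: "ln (real n) > 0" using that assms(1) by simp
    ultimately have "(real d * ln (real n) - K) / ln (real n) \<le> ln (real (f n)) / ln (real n)"
      by (intro divide_right_mono) auto
    then show ?thesis
      using pos by (simp add: log_def diff_divide_distrib)
  qed
  then have "limsup (\<lambda>r::nat. ereal (real d - K / ln (real r)))
      \<le> limsup (\<lambda>r. ereal (log (real r) (real (f r))))"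
    by (intro Limsup_mono eventually_sequentiallyI[of "C + 1"]) simp
  moreover have "limsup (\<lambda>r::nat. ereal (real d - K / ln (real r))) = ereal (real d)"
    using lim by (intro lim_imp_Limsup) simp_all
  ultimately show ?thesis by simp
qed

text \<open>The span of \<open>U\<close> is itself one of the subspaces in the supremum, so any
  auxiliary finite set containing 1 yields a lower bound for the whole ring.\<close>

lemma growth_degree_le_GKdim:
  fixes U :: "'a::division_ring set"
  assumes "growth_degree U d" "finite U" "1 \<in> U"
  shows "ereal (real d) \<le> GKdim (center :: 'a set)"
proof -
  let ?V = "cv.span U"
  obtain C where C: "C \<ge> 1" "\<And>r. r \<ge> 1 \<Longrightarrow> r ^ d \<le> fdim center (spow center U (C * r))"
    using assms(1) unfolding growth_degree_def by blast
  have "ereal (real d) \<le> limsup (\<lambda>r. ereal (log (real r) (real (fdim center (spow center ?V r)))))"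
    unfolding spow_span using C assms(2,3)
    by (intro limsup_log_ge[of C]) (auto intro: monoI fdim_spow_mono_exponent)
  also have "\<dots> \<le> GKdim (center :: 'a set)"
    unfolding GKdim_def
    by (rule Sup_upper) (use assms in \<open>auto simp: fspan_center fin_dim_center_span intro: cv.span_base\<close>)
  finally show ?thesis .
qed

section \<open>Reduction to commuting sets\<close>

lemma generators_subset_gen_division_subring: "S \<subseteq> gen_division_subring S"
  by (auto simp: gen_division_subring_def)

lemma division_subring_gen: "division_subring (gen_division_subring S)"
  by (simp add: gen_division_subring_def division_subring_def)

text \<open>The coordinates in \<open>W\<close> are central in \<open>K\<close>, so they commute
  with each other and with \<open>T\<close>. They need not be central in the whole ring, which is
  why \<open>W\<close> can carry the growth over \<open>center\<close>.\<close>

lemma spow_growth_bounded_by_commuting: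
  fixes T :: "'a::division_ring set"
  assumes "weakly_locally_finite TYPE('a)" "finite T"
  obtains W :: "'a set" and N s where "finite W" "\<And>x y. x \<in> W \<Longrightarrow> y \<in> W \<Longrightarrow> x * y = y * x"
    "\<And>r. fdim center (spow center T r) \<le> N * fdim center (spow center (insert 1 W) (s + s * r))"
proof -
  define K where "K = gen_division_subring T"
  define Z where "Z = center_of K"
  have "fin_dim Z K"
    using assms(1,2) unfolding weakly_locally_finite_def Let_def K_def Z_def by blast
  then obtain E where E: "finite E" "fspan Z E = K"
    by (auto simp: fin_dim_def)
  have K: "division_subring K" "T \<subseteq> K"
    unfolding K_def by (rule division_subring_gen generators_subset_gen_division_subring)+
  have Z0: "0 \<in> Z" and Z1: "1 \<in> Z"
    using K(1) by (auto simp: Z_def center_of_def division_subring_def)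
  have Z_comm: "z * x = x * z" if "z \<in> Z" "x \<in> K" for z x
    using that by (auto simp: Z_def center_of_def)
  have E_K: "E \<subseteq> K"
  proof
    fix e assume "e \<in> E"
    then have "e \<in> fspan Z E"
      unfolding fspan_def using Z1 by (auto intro!: exI[of _ "{e}"] exI[of _ "\<lambda>_. 1"])
    then show "e \<in> K" using E(2) by simp
  qed
  have coords: "\<exists>c. (\<forall>e\<in>E. c e \<in> Z) \<and> x = (\<Sum>e\<in>E. c e * e)" if x: "x \<in> K" for x
  proof -
    obtain T c where *: "finite T" "T \<subseteq> E" "\<And>t. t \<in> T \<Longrightarrow> c t \<in> Z" "x = (\<Sum>t\<in>T. c t * t)"
      using x unfolding E(2)[symmetric] fspan_def by auto
    have "x = (\<Sum>e\<in>E. (if e \<in> T then c e else 0) * e)"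
      unfolding *(4) using *(2) E(1) by (intro sum.mono_neutral_cong_left) auto
    then show ?thesis
      using *(3) Z0 by (intro exI[of _ "\<lambda>e. if e \<in> T then c e else 0"]) auto
  qed
  \<comment> \<open>\<open>E\<close> is only a spanning set, so coordinates need not be unique and a
    choice is fixed.\<close>
  define co where "co x = (SOME c. (\<forall>e\<in>E. c e \<in> Z) \<and> x = (\<Sum>e\<in>E. c e * e))" for x
  have co: "e \<in> E \<Longrightarrow> co x e \<in> Z" "x = (\<Sum>e\<in>E. co x e * e)" if "x \<in> K" for x e
    using someI_ex[OF coords[OF that]] unfolding co_def by auto
  \<comment> \<open>The element 1 is included because the products of letters of \<open>T\<close>
    are built up starting from it.\<close>
  define A where "A = insert 1 ((\<lambda>(t, e). t * e) ` (T \<times> E))"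
  have A_K: "A \<subseteq> K"
    using K E_K by (auto simp: A_def division_subring_def)
  define W where "W = (\<lambda>(x, e). co x e) ` (A \<times> E)"
  have W_Z: "W \<subseteq> Z" using co(1) A_K by (auto simp: W_def)
  have "finite A" using assms(2) E(1) by (simp add: A_def)
  then have "finite W" using E(1) by (simp add: W_def)
  have Z_K: "Z \<subseteq> K" by (auto simp: Z_def center_of_def)
  have A_ext: "x \<in> spow_ext (insert 1 W) E 1" if "x \<in> A" for x
  proof -
    have "(\<Sum>e\<in>E. co x e * e) \<in> spow_ext (insert 1 W) E 1"
    proof (intro cv.subspace_sum subspace_spow_ext spow_extI in_spow_1)
      fix e assume "e \<in> E"
      then show "co x e \<in> insert 1 W" using that by (auto simp: W_def)
    qed
    then show ?thesis using co(2)[of x] that A_K by auto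
  qed
  \<comment> \<open>No denominator has to be cleared, since the coordinates of each
    \<open>t * e\<close> belong to \<open>W\<close>: thus \<open>c = 1\<close>, and each letter
    raises the degree by \<open>s = 1\<close>.\<close>
  have "fdim center (spow center T r) \<le> card E * fdim center (spow center (insert 1 W) (1 + 1 * r))"
    for r
  proof (rule fdim_spow_le_finite_extension[where c = 1])
    fix x u assume "x \<in> insert 1 W" "u \<in> T"
    then show "x * u = u * x" using Z_comm W_Z K(2) by auto
  next
    fix u e assume "u \<in> T" "e \<in> E"
    then show "1 * u * e \<in> spow_ext (insert 1 W) E 1"
      by (intro A_ext) (auto simp: A_def)
  next
    show "1 \<in> spow_ext (insert 1 W) E 1" by (rule A_ext) (simp add: A_def)
  qed (use E(1) \<open>finite W\<close> in auto)
  then show thesis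
    using that[of W "card E" 1] \<open>finite W\<close> Z_comm W_Z Z_K by blast
qed

text \<open>The natural numbers below \<open>Sup S\<close> either have a maximum, which then equals
  \<open>Sup S\<close>, or are unbounded. The elements of \<open>S\<close> are only sandwiched,
  since the degree that bounds one of them is attained by another subspace.\<close>

lemma Sup_natural_or_infinity:
  fixes S :: "ereal set"
  assumes "S \<noteq> {}" "\<And>x. x \<in> S \<Longrightarrow> \<exists>n::nat. x \<le> ereal (real n) \<and> ereal (real n) \<le> Sup S"
  shows "(\<exists>n::nat. Sup S = ereal (real n)) \<or> Sup S = \<infinity>"
proof -
  define M where "M = {n::nat. ereal (real n) \<le> Sup S}"
  have "M \<noteq> {}" using assms unfolding M_def by blast
  show ?thesis
  proof (cases "finite M")
    case True
    have "x \<le> ereal (real (Max M))" if x: "x \<in> S" for x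
    proof -
      obtain n where n: "x \<le> ereal (real n)" "n \<in> M"
        using assms(2)[OF x] by (auto simp: M_def)
      then have "ereal (real n) \<le> ereal (real (Max M))" using True by simp
      with n(1) show ?thesis by (rule order_trans)
    qed
    then have "Sup S \<le> ereal (real (Max M))" by (rule Sup_least)
    moreover have "ereal (real (Max M)) \<le> Sup S"
      using Max_in[OF True \<open>M \<noteq> {}\<close>] by (simp add: M_def)
    ultimately show ?thesis using antisym by blast
  next
    case False
    have "Sup S = \<infinity>"
    proof (rule ereal_top)
      fix B :: real
      obtain k :: nat where "B \<le> real k" using real_arch_simple by blast
      moreover obtain n where "n \<in> M" "n > k" using False infinite_nat_iff_unbounded by blast
      ultimately show "ereal B \<le> Sup S"
        unfolding M_def by (auto elim: order_trans[rotated])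
    qed
    then show ?thesis by simp
  qed
qed

theorem theorem3p1:
  assumes "weakly_locally_finite TYPE('a::division_ring)"
  shows "(\<exists>n::nat. GKdim (center :: 'a set) = ereal (real n)) \<or> GKdim (center :: 'a set) = \<infinity>"
proof -
  let ?g = "\<lambda>V::'a set. limsup (\<lambda>r::nat. ereal (log (real r) (real (fdim center (spow center V r)))))"
  let ?S = "{?g V | V. fspan center V = V \<and> fin_dim center V \<and> (1::'a) \<in> V}"
  have "fspan center (cv.span {1}) = cv.span {1}" "fin_dim center (cv.span {1::'a})"
    "(1::'a) \<in> cv.span {1}"
    by (simp_all add: fspan_center fin_dim_center_span cv.span_base)
  then have "?S \<noteq> {}" by blast
  moreover have "\<exists>n::nat. x \<le> ereal (real n) \<and> ereal (real n) \<le> Sup ?S" if x: "x \<in> ?S" for x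
  proof -
    obtain V where V: "x = ?g V" "fspan center V = V" "fin_dim center V" "(1::'a) \<in> V"
      using x by blast
    obtain T where T: "finite T" "cv.span T = V"
      using V(3) by (auto simp: fin_dim_def fspan_center)
    obtain W :: "'a set" and N s where W: "finite W" "\<And>x y. x \<in> W \<Longrightarrow> y \<in> W \<Longrightarrow> x * y = y * x"
      and le: "\<And>r. fdim center (spow center T r) \<le>
        N * fdim center (spow center (insert 1 W) (s + s * r))"
      using spow_growth_bounded_by_commuting[OF assms T(1)] by metis
    obtain d where d: "growth_degree (insert 1 W) d"
      using growth_degree_exists[OF W] by blast
    obtain C where "C \<ge> 1" "\<And>r. r \<ge> 1 \<Longrightarrow> fdim center (spow center T r) \<le> C * r ^ d"
      using growth_degree_upper_extension[OF d le] W(1) by (metis finite_insert insertI1)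
    then have "?g T \<le> ereal (real d)"
      by (rule limsup_log_le)
    then have "x \<le> ereal (real d)"
      using V(1) spow_span[of T] T(2) by simp
    \<comment> \<open>\<open>W\<close> need not lie in \<open>V\<close>, so \<open>d\<close> is
      compared from below with the supremum and not with \<open>x\<close>.\<close>
    moreover have "ereal (real d) \<le> Sup ?S"
      using growth_degree_le_GKdim[OF d] W(1) unfolding GKdim_def by simp
    ultimately show ?thesis by blast
  qed
  ultimately show ?thesis
    unfolding GKdim_def by (rule Sup_natural_or_infinity)
qed

end
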